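(* Let $n\ge1$. For each positive restricted root $\bm\alpha\in\Sigma_+$ let $\bm K_{\bm\alpha}\in\mathfrak k$ be the Hamiltonian matrix of the passive generator assigned to $\bm\alpha$ by $$2\bm e_j\leftrightarrow\hat g_j^{\mathrm{rot}},\qquad \bm e_j-\bm e_k\leftrightarrow\hat g_{jk}^{\mathrm{bsY}},\qquad \bm e_j+\bm e_k\leftrightarrow\hat g_{jk}^{\mathrm{bsX}}.$$ Then there is an active matrix $\bm P_{\bm\alpha}\in\mathfrak p$ such that for all $\bm r\in\mathbb R^n$ $$[\bm A(\bm r),\bm K_{\bm\alpha}]=\bm\alpha(\bm r)\,\bm P_{\bm\alpha},\qquad [\bm A(\bm r),\bm P_{\bm\alpha}]=\bm\alpha(\bm r)\,\bm K_{\bm\alpha}.$$ The assignment $\bm\alpha\mapsto\bm K_{\bm\alpha}$ is a bijection between $\Sigma_+$ and a basis of $\mathfrak k$; here $|\Sigma_+|=n+n(n-1)=n^2=\dim\mathrm u(n)$, every restricted root has multiplicity one, and the centralizer of $\mathfrak a$ in $\mathfrak k$ is trivial.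
   Context: Phase space: for $n$ bosonic modes with $\hat a_j=(\hat q_j+i\hat p_j)/\sqrt2$, $[\hat a_j,\hat a_k^\dagger]=\delta_{jk}$, put $\hat{\bm\chi}=(\hat q_1,\dots,\hat q_n,\hat p_1,\dots,\hat p_n)^{\mathrm T}$ and $\bm\Omega=\begin{pmatrix}\bm 0&\bm I_n\\-\bm I_n&\bm 0\end{pmatrix}$, so $[\hat\chi_a,\hat\chi_b]=i\Omega_{ab}$. A Hermitian quadratic operator $\hat g=\tfrac12\hat{\bm\chi}^{\mathrm T}\bm G\hat{\bm\chi}+c$ with $\bm G$ real symmetric and $c\in\mathbb R$ has Hamiltonian matrix $\bm K=\bm\Omega\bm G\in\mathrm{sp}(2n,\mathbb R)$. Generators: $\hat g_j^{\mathrm{rot}}=\hat a_j^\dagger\hat a_j$ for $1\le j\le n$; $\hat g_{jk}^{\mathrm{bsX}}=\hat a_j^\dagger\hat a_k+\hat a_k^\dagger\hat a_j$, $\hat g_{jk}^{\mathrm{bsY}}=-i(\hat a_j^\dagger\hat a_k-\hat a_k^\dagger\hat a_j)$ for $1\le j<k\le n$ (passive); $\hat g_j^{\mathrm{sqX}}=\tfrac12(\hat a_j^{\dagger2}+\hat a_j^2)$, $\hat g_j^{\mathrm{sqY}}=-\tfrac i2(\hat a_j^{\dagger2}-\hat a_j^2)$, $\hat g_{jk}^{\mathrm{tsX}}=\hat a_j^\dagger\hat a_k^\dagger+\hat a_j\hat a_k$, $\hat g_{jk}^{\mathrm{tsY}}=-i(\hat a_j^\dagger\hat a_k^\dagger-\hat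 a_j\hat a_k)$ (active). $\mathfrak k\simeq\mathrm u(n)$ is the real span of the Hamiltonian matrices of the passive generators and $\mathfrak p$ the real span of those of the active generators, so $\mathrm{sp}(2n,\mathbb R)=\mathfrak k\oplus\mathfrak p$. Squeezing flat: $\bm A(\bm r)=\begin{pmatrix}-\bm R&\bm 0\\ \bm 0&\bm R\end{pmatrix}$ with $\bm R=\mathrm{diag}(r_1,\dots,r_n)$, and $\mathfrak a=\{\bm A(\bm r):\bm r\in\mathbb R^n\}\subset\mathfrak p$. Positive restricted roots: with $\bm e_j(\bm r)=r_j$, $\Sigma_+=\{2\bm e_j\}_{j=1}^n\cup\{\bm e_j-\bm e_k,\bm e_j+\bm e_k\}_{1\le j<k\le n}$. The multiplicity of a restricted root $\bm\alpha$ is the real dimension of $\{\bm X\in\mathrm{sp}(2n,\mathbb R):[\bm A(\bm r),\bm X]=\bm\alpha(\bm r)\bm X\ \forall\bm r\in\mathbb R^n\}$. *)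

theory Defs
  imports "HOL-Analysis.Analysis"
begin

text \<open>
  The modes are indexed by a finite linearly ordered type \<open>'n\<close>, so that \<open>n = CARD('n) \<ge> 1\<close>.
  Phase space is indexed by \<open>'n + 'n\<close>: \<open>Inl j\<close> stands for the position and \<open>Inr j\<close> for the
  momentum of mode \<open>j\<close>.
\<close>

type_synonym 'n phase_mat = "real ^ ('n + 'n) ^ ('n + 'n)"
type_synonym 'n functional = "real ^ 'n \<Rightarrow> real"
type_synonym 'n complex_mat = "complex ^ 'n ^ 'n"

definition block_mat ::
  "real ^ 'n ^ 'n \<Rightarrow> real ^ 'n ^ 'n \<Rightarrow> real ^ 'n ^ 'n \<Rightarrow> real ^ 'n ^ 'n \<Rightarrow> 'n::finite phase_mat" where
  "block_mat A B C D = (\<chi> a b. case a of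
       Inl j \<Rightarrow> (case b of Inl k \<Rightarrow> A $ j $ k | Inr k \<Rightarrow> B $ j $ k)
     | Inr j \<Rightarrow> (case b of Inl k \<Rightarrow> C $ j $ k | Inr k \<Rightarrow> D $ j $ k))"

definition Omega :: "'n::finite phase_mat" where
  "Omega = block_mat 0 (mat 1) (- mat 1) 0"

definition commutator :: "'n::finite phase_mat \<Rightarrow> 'n phase_mat \<Rightarrow> 'n phase_mat" where
  "commutator X Y = X ** Y - Y ** X"

definition sp :: "'n::finite phase_mat set" where
  "sp = {X. transpose X ** Omega + Omega ** X = 0}"


section \<open>Bosonic modes\<close>

definition quadrature :: "('n \<Rightarrow> 'v \<Rightarrow> 'v) \<Rightarrow> ('n \<Rightarrow> 'v \<Rightarrow> 'v) \<Rightarrow> 'n + 'n \<Rightarrow> 'v \<Rightarrow> 'v" where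
  "quadrature q p a = (case a of Inl j \<Rightarrow> q j | Inr j \<Rightarrow> p j)"

text \<open>
  The type \<open>'v\<close> plays the role of a common invariant domain of the (unbounded) position and
  momentum operators, for instance the finite-particle vectors in Fock space: a nonzero complex
  inner product space on which these operators are everywhere defined, symmetric and satisfy the
  canonical commutation relations.  The inner product is conjugate-linear in its first argument.
\<close>

locale bosonic_modes = vector_space smul
  for smul :: "complex \<Rightarrow> 'v::ab_group_add \<Rightarrow> 'v" +
  fixes ip :: "'v \<Rightarrow> 'v \<Rightarrow> complex"
    and q p :: "'n::{finite,linorder} \<Rightarrow> 'v \<Rightarrow> 'v"
  assumes ip_add: "ip u (v + w) = ip u v + ip u w"
    and ip_scale: "ip u (smul c v) = c * ip u v"
    and ip_cnj: "ip v u = cnj (ip u v)"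
    and ip_pos: "v \<noteq> 0 \<Longrightarrow> Re (ip v v) > 0"
    and nontrivial: "\<exists>v::'v. v \<noteq> 0"
    and linear_quadrature: "Vector_Spaces.linear smul smul (quadrature q p a)"
    and symmetric_quadrature: "ip (quadrature q p a u) v = ip u (quadrature q p a v)"
    and ccr: "quadrature q p a (quadrature q p b v) - quadrature q p b (quadrature q p a v)
        = smul (\<i> * of_real (Omega $ a $ b)) v"

definition annihilation ::
  "(complex \<Rightarrow> 'v::ab_group_add \<Rightarrow> 'v) \<Rightarrow> ('n \<Rightarrow> 'v \<Rightarrow> 'v) \<Rightarrow> ('n \<Rightarrow> 'v \<Rightarrow> 'v) \<Rightarrow> 'n \<Rightarrow> 'v \<Rightarrow> 'v" where
  "annihilation smul q p j v = smul (1 / of_real (sqrt 2)) (q j v + smul \<i> (p j v))"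

definition creation ::
  "(complex \<Rightarrow> 'v::ab_group_add \<Rightarrow> 'v) \<Rightarrow> ('n \<Rightarrow> 'v \<Rightarrow> 'v) \<Rightarrow> ('n \<Rightarrow> 'v \<Rightarrow> 'v) \<Rightarrow> 'n \<Rightarrow> 'v \<Rightarrow> 'v" where
  "creation smul q p j v = smul (1 / of_real (sqrt 2)) (q j v - smul \<i> (p j v))"

lemma (in bosonic_modes) creation_adjoint:
  "ip (annihilation smul q p j u) v = ip u (creation smul q p j v)"
proof -
  have q: "ip (q j u) v = ip u (q j v)" and p: "ip (p j u) v = ip u (p j v)" for u v
    using symmetric_quadrature[of "Inl j" u v] symmetric_quadrature[of "Inr j" u v]
    by (simp_all add: quadrature_def)
  have add': "ip (x + y) z = ip x z + ip y z" for x y z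
    by (metis ip_cnj ip_add complex_cnj_add)
  have smul': "ip (smul c x) z = cnj c * ip x z" for c x z
    by (metis ip_cnj ip_scale complex_cnj_mult)
  have diff: "ip x (y - z) = ip x y - ip x z" for x y z
    using ip_add[of x "y - z" z] by simp
  show ?thesis
    by (simp add: annihilation_def creation_def add' smul' ip_scale diff q p algebra_simps)
qed

text \<open>
  The Hamiltonian matrix of \<open>g = 1/2 \<chi>\<^sup>T G \<chi> + c\<close>.  The matrix \<open>G\<close> is determined by \<open>g\<close>: by the
  canonical commutation relations, taking commutators of \<open>g\<close> with two quadratures yields the
  entries of \<open>Omega ** G ** Omega\<close> up to sign.
\<close>

definition hamiltonian_matrix ::
  "(complex \<Rightarrow> 'v::ab_group_add \<Rightarrow> 'v) \<Rightarrow> ('n::finite \<Rightarrow> 'v \<Rightarrow> 'v) \<Rightarrow> ('n \<Rightarrow> 'v \<Rightarrow> 'v)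
    \<Rightarrow> ('v \<Rightarrow> 'v) \<Rightarrow> 'n phase_mat" where
  "hamiltonian_matrix smul q p g = (THE K. \<exists>G (c :: real).
      transpose G = G \<and>
      (\<forall>v. g v = smul (1/2) (\<Sum>a\<in>UNIV. \<Sum>b\<in>UNIV.
                    smul (of_real (G $ a $ b)) (quadrature q p a (quadrature q p b v)))
               + smul (of_real c) v) \<and>
      K = Omega ** G)"


section \<open>Generators\<close>

context
  fixes smul :: "complex \<Rightarrow> 'v::ab_group_add \<Rightarrow> 'v"
    and q p :: "'n::{finite,linorder} \<Rightarrow> 'v \<Rightarrow> 'v"
begin

private abbreviation "an \<equiv> annihilation smul q p"
private abbreviation "cr \<equiv> creation smul q p"

definition g_rot :: "'n \<Rightarrow> 'v \<Rightarrow> 'v" where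
  "g_rot j v = cr j (an j v)"

definition g_bsX :: "'n \<Rightarrow> 'n \<Rightarrow> 'v \<Rightarrow> 'v" where
  "g_bsX j k v = cr j (an k v) + cr k (an j v)"

definition g_bsY :: "'n \<Rightarrow> 'n \<Rightarrow> 'v \<Rightarrow> 'v" where
  "g_bsY j k v = smul (- \<i>) (cr j (an k v) - cr k (an j v))"

definition g_sqX :: "'n \<Rightarrow> 'v \<Rightarrow> 'v" where
  "g_sqX j v = smul (1/2) (cr j (cr j v) + an j (an j v))"

definition g_sqY :: "'n \<Rightarrow> 'v \<Rightarrow> 'v" where
  "g_sqY j v = smul (- \<i>/2) (cr j (cr j v) - an j (an j v))"

definition g_tsX :: "'n \<Rightarrow> 'n \<Rightarrow> 'v \<Rightarrow> 'v" where
  "g_tsX j k v = cr j (cr k v) + an j (an k v)"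

definition g_tsY :: "'n \<Rightarrow> 'n \<Rightarrow> 'v \<Rightarrow> 'v" where
  "g_tsY j k v = smul (- \<i>) (cr j (cr k v) - an j (an k v))"

definition passive_generators :: "('v \<Rightarrow> 'v) set" where
  "passive_generators =
     {g_rot j | j. True} \<union> {g_bsX j k | j k. j < k} \<union> {g_bsY j k | j k. j < k}"

definition active_generators :: "('v \<Rightarrow> 'v) set" where
  "active_generators =
     {g_sqX j | j. True} \<union> {g_sqY j | j. True} \<union>
     {g_tsX j k | j k. j < k} \<union> {g_tsY j k | j k. j < k}"

definition k_alg :: "'n phase_mat set" where
  "k_alg = span (hamiltonian_matrix smul q p ` passive_generators)"

definition p_space :: "'n phase_mat set" where
  "p_space = span (hamiltonian_matrix smul q p ` active_generators)"

end


section \<open>Squeezing flat and restricted roots\<close>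

definition diag_mat :: "real ^ 'n \<Rightarrow> real ^ 'n ^ 'n" where
  "diag_mat r = (\<chi> i j. if i = j then r $ i else 0)"

definition squeeze :: "real ^ 'n::finite \<Rightarrow> 'n phase_mat" where
  "squeeze r = block_mat (- diag_mat r) 0 0 (diag_mat r)"

definition squeezing_flat :: "'n::finite phase_mat set" where
  "squeezing_flat = range squeeze"

text \<open>Roots are functionals of the parameter \<open>r\<close> of \<open>squeeze r\<close>.\<close>

definition root_2e :: "'n \<Rightarrow> 'n::finite functional" where
  "root_2e j r = 2 * r $ j"

definition root_diff :: "'n \<Rightarrow> 'n \<Rightarrow> 'n::finite functional" where
  "root_diff j k r = r $ j - r $ k"

definition root_sum :: "'n \<Rightarrow> 'n \<Rightarrow> 'n::finite functional" where
  "root_sum j k r = r $ j + r $ k"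

definition positive_roots :: "'n::{finite,linorder} functional set" where
  "positive_roots =
     {root_2e j | j. True} \<union> {root_diff j k | j k. j < k} \<union> {root_sum j k | j k. j < k}"

definition root_space :: "'n::finite functional \<Rightarrow> 'n phase_mat set" where
  "root_space \<alpha> = {X \<in> sp. \<forall>r. commutator (squeeze r) X = \<alpha> r *\<^sub>R X}"

definition restricted_root :: "'n::finite functional \<Rightarrow> bool" where
  "restricted_root \<alpha> \<longleftrightarrow> linear \<alpha> \<and> \<alpha> \<noteq> (\<lambda>r. 0) \<and> root_space \<alpha> \<noteq> {0}"

definition root_multiplicity :: "'n::finite functional \<Rightarrow> nat" where
  "root_multiplicity \<alpha> = dim (root_space \<alpha>)"

definition centralizer_in :: "'n::finite phase_mat set \<Rightarrow> 'n phase_mat set \<Rightarrow> 'n phase_mat set" where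
  "centralizer_in L S = {X \<in> L. \<forall>Y\<in>S. commutator Y X = 0}"

text \<open>The real Lie algebra \<open>u(n)\<close>: skew-Hermitian complex matrices.\<close>

definition u_alg :: "'n::finite complex_mat set" where
  "u_alg = {X. \<forall>i j. X $ i $ j = - cnj (X $ j $ i)}"

end

theory Submission imports Defs
begin

text \<open>
  The commutator of \<open>squeeze r\<close> with the matrix unit at \<open>(a, b)\<close> is \<open>weight a r - weight b r\<close> times
  that unit, where the weights are \<open>- r\<^sub>j\<close> on positions and \<open>r\<^sub>j\<close> on momenta.  Two index pairs off
  the diagonal have the same weight difference only if they coincide or are exchanged by swapping
  the pair and conjugating both indices; the condition of \<open>sp\<close> ties the entries at such
  pairs to each other, so every root space is a line.  The Hamiltonian matrices of the generators are short sums of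
  matrix units, and a quadratic operator determines its symmetric matrix because its double
  commutators with the quadratures do.  Matrices in \<open>k\<close> are antisymmetric, hence have zero
  diagonal, whereas the centralizer of the flat consists of diagonal matrices.
\<close>

section \<open>Matrix units on phase space\<close>

text \<open>Together with \<open>index_sign\<close> this presents \<open>Omega\<close> as a signed
  permutation matrix, so that multiplying by it only relabels rows or columns and changes
  signs.\<close>

primrec conj_index :: "'n + 'n \<Rightarrow> 'n + 'n" where
  "conj_index (Inl j) = Inr j"
| "conj_index (Inr j) = Inl j"

primrec index_sign :: "'n + 'n \<Rightarrow> real" where
  "index_sign (Inl j) = 1"
| "index_sign (Inr j) = - 1"

primrec weight :: "'n + 'n \<Rightarrow> real ^ 'n::finite \<Rightarrow> real" where
  "weight (Inl j) r = - r $ j"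
| "weight (Inr j) r = r $ j"

definition matrix_unit :: "'m \<Rightarrow> 'm \<Rightarrow> real ^ 'm ^ 'm" where
  "matrix_unit a b = (\<chi> i j. if i = a \<and> j = b then 1 else 0)"

lemma matrix_unit_nth: "matrix_unit a b $ i $ j = (if i = a \<and> j = b then 1 else 0)"
  by (simp add: matrix_unit_def)

lemma transpose_matrix_unit: "transpose (matrix_unit a b) = matrix_unit b a"
  by (simp add: vec_eq_iff transpose_def matrix_unit_nth conj_commute)

lemma transpose_add: "transpose (X + Y) = transpose X + transpose Y"
  and transpose_diff: "transpose (X - Y) = transpose X - transpose Y"
  and transpose_minus: "transpose (- X) = - transpose X"
  and transpose_scaleR: "transpose (c *\<^sub>R X) = c *\<^sub>R transpose X"
  for X Y :: "real ^ 'm::finite ^ 'm"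
  by (simp_all add: vec_eq_iff transpose_def)

text \<open>For \<open>a = b\<close> this is twice the unit, which is where the factors 1/2 of the
  single-mode generators come from.\<close>

definition symmetrized_unit :: "'m \<Rightarrow> 'm \<Rightarrow> real ^ 'm ^ 'm" where
  "symmetrized_unit a b = matrix_unit a b + matrix_unit b a"

lemma transpose_symmetrized_unit: "transpose (symmetrized_unit a b) = symmetrized_unit a b"
  by (simp add: symmetrized_unit_def transpose_add transpose_matrix_unit add.commute)

section \<open>Entrywise description of \<open>Omega\<close>, of brackets with the flat, and of
  \<open>sp\<close>\<close>

lemma conj_index_conj_index [simp]: "conj_index (conj_index a) = a"
  by (cases a) auto

lemma index_sign_conj_index [simp]: "index_sign (conj_index a) = - index_sign a"
  by (cases a) auto

lemma index_sign_neq_0 [simp]: "index_sign a \<noteq> 0"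
  by (cases a) auto

lemma index_sign_square [simp]: "index_sign a * index_sign a = 1"
  by (cases a) auto

lemma Omega_nth: "Omega $ a $ b = (if b = conj_index a then index_sign a else 0)"
  by (auto simp: Omega_def block_mat_def mat_def split: sum.split)

lemma Omega_nth': "Omega $ a $ b = (if a = conj_index b then - index_sign b else 0)"
  by (auto simp: Omega_nth)

lemma Omega_mult_nth: "(Omega ** X) $ a $ b = index_sign a * X $ conj_index a $ b"
  by (simp add: matrix_matrix_mult_def Omega_nth if_distrib[of "\<lambda>x. x * _"] cong: if_cong)

lemma mult_Omega_nth: "(X ** Omega) $ a $ b = - X $ a $ conj_index b * index_sign b"
  by (simp add: matrix_matrix_mult_def Omega_nth' if_distrib[of "\<lambda>x. _ * x"] cong: if_cong)

lemma Omega_mult_matrix_unit: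
  "Omega ** matrix_unit a b = - index_sign a *\<^sub>R matrix_unit (conj_index a) b"
  by (auto simp: vec_eq_iff Omega_mult_nth matrix_unit_nth)

lemma squeeze_nth: "squeeze r $ a $ b = (if a = b then weight a r else 0)"
  by (auto simp: squeeze_def block_mat_def diag_mat_def split: sum.split)

lemma commutator_squeeze_nth:
  "commutator (squeeze r) X $ a $ b = (weight a r - weight b r) * X $ a $ b"
  by (simp add: commutator_def matrix_matrix_mult_def squeeze_nth
      if_distrib[of "\<lambda>x. x * _"] if_distrib[of "\<lambda>x. _ * x"] algebra_simps cong: if_cong)

text \<open>As \<open>Omega\<close> is antisymmetric, the defining equation of \<open>sp\<close>
  says that \<open>Omega ** X\<close> is symmetric; the right-hand side spells this out.\<close>

lemma in_sp_iff:
  "X \<in> sp \<longleftrightarrow> (\<forall>a b. index_sign a * X $ conj_index a $ b = index_sign b * X $ conj_index b $ a)"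
  by (auto simp: sp_def vec_eq_iff Omega_mult_nth mult_Omega_nth transpose_def algebra_simps)

lemma Omega_mult_in_sp: "transpose G = G \<Longrightarrow> Omega ** G \<in> sp"
  by (auto simp: in_sp_iff Omega_mult_nth transpose_def vec_eq_iff)

text \<open>This ties together the two places of a matrix that share one weight difference, and so
  makes root spaces one-dimensional.\<close>

lemma sp_nth_eq_0_iff:
  assumes "X \<in> sp"
  shows "X $ conj_index b $ conj_index a = 0 \<longleftrightarrow> X $ a $ b = 0"
  using assms[unfolded in_sp_iff, rule_format, of "conj_index a" b]
  by (metis conj_index_conj_index index_sign_neq_0 mult_eq_0_iff)

lemma subspace_sp: "subspace sp"
  by (simp add: subspace_def in_sp_iff algebra_simps)


section \<open>The matrices of the generators\<close>

lemma Omega_mult_add: "Omega ** (X + Y) = Omega ** X + Omega ** Y"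
  and Omega_mult_diff: "Omega ** (X - Y) = Omega ** X - Omega ** Y"
  and Omega_mult_minus: "Omega ** (- X) = - (Omega ** X)"
  and Omega_mult_scaleR: "Omega ** (c *\<^sub>R X) = c *\<^sub>R (Omega ** X)"
  by (simp_all add: vec_eq_iff Omega_mult_nth algebra_simps)

text \<open>The factor to the right of \<open>Omega\<close> is the symmetric matrix of the quadratic
  operator. Equal modes are allowed, so that rotations and single-mode squeezers are halves of the
  case \<open>j = k\<close>.\<close>

definition bsX_matrix :: "'n \<Rightarrow> 'n \<Rightarrow> 'n::finite phase_mat" where
  "bsX_matrix j k = Omega ** (symmetrized_unit (Inl j) (Inl k) + symmetrized_unit (Inr j) (Inr k))"

definition bsY_matrix :: "'n \<Rightarrow> 'n \<Rightarrow> 'n::finite phase_mat" where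
  "bsY_matrix j k = Omega ** (symmetrized_unit (Inl j) (Inr k) - symmetrized_unit (Inr j) (Inl k))"

definition tsX_matrix :: "'n \<Rightarrow> 'n \<Rightarrow> 'n::finite phase_mat" where
  "tsX_matrix j k = Omega ** (symmetrized_unit (Inl j) (Inl k) - symmetrized_unit (Inr j) (Inr k))"

definition tsY_matrix :: "'n \<Rightarrow> 'n \<Rightarrow> 'n::finite phase_mat" where
  "tsY_matrix j k = Omega ** (- symmetrized_unit (Inl j) (Inr k) - symmetrized_unit (Inr j) (Inl k))"

lemmas generator_matrix_defs = bsX_matrix_def bsY_matrix_def tsX_matrix_def tsY_matrix_def

lemma generator_matrix_in_sp:
  "bsX_matrix j k \<in> sp" "bsY_matrix j k \<in> sp" "tsX_matrix j k \<in> sp" "tsY_matrix j k \<in> sp"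
  unfolding generator_matrix_defs
  by (intro Omega_mult_in_sp; simp add: transpose_add transpose_diff transpose_minus
      transpose_symmetrized_unit)+

lemma generator_matrix_eq:
  shows bsX_matrix_eq: "bsX_matrix j k = matrix_unit (Inl j) (Inr k) + matrix_unit (Inl k) (Inr j)
      - matrix_unit (Inr j) (Inl k) - matrix_unit (Inr k) (Inl j)"
    and bsY_matrix_eq: "bsY_matrix j k = matrix_unit (Inl k) (Inl j) - matrix_unit (Inl j) (Inl k)
      + matrix_unit (Inr k) (Inr j) - matrix_unit (Inr j) (Inr k)"
    and tsX_matrix_eq: "tsX_matrix j k = - matrix_unit (Inl j) (Inr k) - matrix_unit (Inl k) (Inr j)
      - matrix_unit (Inr j) (Inl k) - matrix_unit (Inr k) (Inl j)"
    and tsY_matrix_eq: "tsY_matrix j k = matrix_unit (Inr j) (Inr k) + matrix_unit (Inr k) (Inr j)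
      - matrix_unit (Inl j) (Inl k) - matrix_unit (Inl k) (Inl j)"
  by (simp_all add: generator_matrix_defs symmetrized_unit_def Omega_mult_add Omega_mult_diff
      Omega_mult_minus Omega_mult_matrix_unit)

lemma commutator_squeeze_linear:
  "commutator (squeeze r) (X + Y) = commutator (squeeze r) X + commutator (squeeze r) Y"
  "commutator (squeeze r) (X - Y) = commutator (squeeze r) X - commutator (squeeze r) Y"
  "commutator (squeeze r) (- X) = - commutator (squeeze r) X"
  "commutator (squeeze r) (c *\<^sub>R X) = c *\<^sub>R commutator (squeeze r) X"
  by (simp_all add: vec_eq_iff commutator_squeeze_nth algebra_simps)

lemma commutator_squeeze_matrix_unit:
  "commutator (squeeze r) (matrix_unit a b) = (weight a r - weight b r) *\<^sub>R matrix_unit a b"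
  by (simp add: vec_eq_iff commutator_squeeze_nth matrix_unit_nth)

text \<open>All units in one generator have the same weight difference up to sign, so the bracket
  only changes relative signs and thereby exchanges passive and active. The minus signs of the last
  two equations explain \<open>- tsY_matrix\<close> in \<open>active_matrix\<close>.\<close>

lemma commutator_squeeze_generator:
  "commutator (squeeze r) (bsX_matrix j k) = root_sum j k r *\<^sub>R tsX_matrix j k"
  "commutator (squeeze r) (tsX_matrix j k) = root_sum j k r *\<^sub>R bsX_matrix j k"
  "commutator (squeeze r) (bsY_matrix j k) = - (root_diff j k r *\<^sub>R tsY_matrix j k)"
  "commutator (squeeze r) (tsY_matrix j k) = - (root_diff j k r *\<^sub>R bsY_matrix j k)"
  by (simp_all add: generator_matrix_eq commutator_squeeze_linear commutator_squeeze_matrix_unit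
      root_sum_def root_diff_def algebra_simps)


section \<open>Positive roots indexed by pairs of modes\<close>

text \<open>
  Since \<open>2e\<^sub>j = e\<^sub>j + e\<^sub>j\<close> and, correspondingly, the passive generator of \<open>2e\<^sub>j\<close> is half of
  \<open>bsX\<close> at \<open>(j, j)\<close>, the pairs \<open>(j, k)\<close> with \<open>j \<le> k\<close> index the sums and those with \<open>j > k\<close> the
  differences.
\<close>

fun pair_root :: "'n \<times> 'n \<Rightarrow> 'n::{finite,linorder} functional" where
  "pair_root (j, k) = (if j \<le> k then root_sum j k else root_diff k j)"

fun passive_matrix :: "'n \<times> 'n \<Rightarrow> 'n::{finite,linorder} phase_mat" where
  "passive_matrix (j, k) =
    (if j < k then bsX_matrix j k else if j = k then (1/2) *\<^sub>R bsX_matrix j k else bsY_matrix k j)"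

fun active_matrix :: "'n \<times> 'n \<Rightarrow> 'n::{finite,linorder} phase_mat" where
  "active_matrix (j, k) =
    (if j < k then tsX_matrix j k else if j = k then (1/2) *\<^sub>R tsX_matrix j k else - tsY_matrix k j)"

text \<open>With \<open>root_column\<close> this marks one entry whose weight difference is the
  given root: in the momentum-position block for a sum, in the momentum-momentum block for a
  difference. Reading off that entry gives functionals dual, up to sign, to the passive
  matrices.\<close>

fun root_row :: "'n \<times> 'n \<Rightarrow> 'n + 'n::{finite,linorder}" where
  "root_row (j, k) = (if j \<le> k then Inr j else Inr k)"

fun root_column :: "'n \<times> 'n \<Rightarrow> 'n + 'n::{finite,linorder}" where
  "root_column (j, k) = (if j \<le> k then Inl k else Inr j)"

lemma mode_pair_cases:
  obtains (less) j k where "x = (j, k)" "j < k"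
  | (diag) j where "x = (j, j)"
  | (greater) j k where "x = (k, j)" "j < (k :: 'n::linorder)"
  by (cases x) (metis linorder_less_linear)

lemma pair_simps:
  fixes j k :: "'n::{finite,linorder}"
  shows "j < k \<Longrightarrow> passive_matrix (j, k) = bsX_matrix j k"
    "passive_matrix (j, j) = (1/2) *\<^sub>R bsX_matrix j j"
    "j < k \<Longrightarrow> passive_matrix (k, j) = bsY_matrix j k"
    "j < k \<Longrightarrow> active_matrix (j, k) = tsX_matrix j k"
    "active_matrix (j, j) = (1/2) *\<^sub>R tsX_matrix j j"
    "j < k \<Longrightarrow> active_matrix (k, j) = - tsY_matrix j k"
    "j < k \<Longrightarrow> pair_root (j, k) = root_sum j k"
    "pair_root (j, j) = root_sum j j"
    "j < k \<Longrightarrow> pair_root (k, j) = root_diff j k"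
    "j < k \<Longrightarrow> root_row (j, k) = Inr j"
    "root_row (j, j) = Inr j"
    "j < k \<Longrightarrow> root_row (k, j) = Inr j"
    "j < k \<Longrightarrow> root_column (j, k) = Inl k"
    "root_column (j, j) = Inl j"
    "j < k \<Longrightarrow> root_column (k, j) = Inr k"
  by auto

declare passive_matrix.simps [simp del]
  active_matrix.simps [simp del]
  pair_root.simps [simp del]
  root_row.simps [simp del]
  root_column.simps [simp del]

lemma root_sum_self: "root_sum j j = root_2e j"
  by (simp add: fun_eq_iff root_sum_def root_2e_def)

lemma range_pair_root: "range (pair_root :: _ \<Rightarrow> 'n::{finite,linorder} functional) = positive_roots"
proof
  have "pair_root x \<in> positive_roots" for x :: "'n \<times> 'n"
    by (cases x rule: mode_pair_cases) (simp_all add: pair_simps root_sum_self positive_roots_def, blast+)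
  then show "range pair_root \<subseteq> (positive_roots :: 'n functional set)" by blast
  have "root_2e j \<in> range pair_root" for j :: 'n
    by (rule range_eqI[of _ _ "(j, j)"]) (simp add: pair_simps root_sum_self)
  moreover have "root_diff j k \<in> range pair_root" if "j < k" for j k :: 'n
    by (rule range_eqI[of _ _ "(k, j)"]) (simp add: pair_simps that)
  moreover have "root_sum j k \<in> range pair_root" if "j < k" for j k :: 'n
    by (rule range_eqI[of _ _ "(j, k)"]) (simp add: pair_simps that)
  ultimately show "positive_roots \<subseteq> range (pair_root :: _ \<Rightarrow> 'n functional)"
    unfolding positive_roots_def by blast
qed

lemma pair_root_eq_weights: "pair_root x r = weight (root_row x) r - weight (root_column x) r"
  by (cases x rule: mode_pair_cases) (simp_all add: pair_simps root_sum_def root_diff_def)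

lemma root_row_neq_root_column: "root_row x \<noteq> root_column x"
  by (cases x rule: mode_pair_cases) (simp_all add: pair_simps)

lemma commutator_squeeze_passive_matrix:
  "commutator (squeeze r) (passive_matrix x) = pair_root x r *\<^sub>R active_matrix x"
  by (cases x rule: mode_pair_cases)
    (simp_all add: pair_simps commutator_squeeze_linear commutator_squeeze_generator)

lemma commutator_squeeze_active_matrix:
  "commutator (squeeze r) (active_matrix x) = pair_root x r *\<^sub>R passive_matrix x"
  by (cases x rule: mode_pair_cases)
    (simp_all add: pair_simps commutator_squeeze_linear commutator_squeeze_generator)

lemma passive_matrix_nth_root: "passive_matrix x $ root_row x $ root_column x = - 1"
  by (cases x rule: mode_pair_cases) (simp_all add: pair_simps generator_matrix_eq matrix_unit_nth)

text \<open>The value agrees with the passive one, so passive and active matrix do not cancel at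
  this entry when added.\<close>

lemma active_matrix_nth_root: "active_matrix x $ root_row x $ root_column x = - 1"
  by (cases x rule: mode_pair_cases) (simp_all add: pair_simps generator_matrix_eq matrix_unit_nth)

lemma bsX_matrix_nth:
  "bsX_matrix l m $ Inr j $ Inl k = - of_bool (j = l \<and> k = m) - of_bool (j = m \<and> k = l)"
  "bsX_matrix l m $ Inr j $ Inr k = 0"
  unfolding bsX_matrix_eq matrix_unit_def by (simp_all add: of_bool_def)

lemma bsY_matrix_nth:
  "bsY_matrix l m $ Inr j $ Inl k = 0"
  "bsY_matrix l m $ Inr j $ Inr k = of_bool (j = m \<and> k = l) - of_bool (j = l \<and> k = m)"
  unfolding bsY_matrix_eq matrix_unit_def by (simp_all add: of_bool_def)

text \<open>Sums and differences occupy different blocks. Within a block a generator also meets the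
  swapped pair, but the order convention on pairs excludes that for
  \<open>x \<noteq> y\<close>.\<close>

lemma passive_matrix_nth_other_root:
  assumes "x \<noteq> y"
  shows "passive_matrix y $ root_row x $ root_column x = 0"
proof -
  obtain j k l m where x: "x = (j, k)" and y: "y = (l, m)" by (cases x, cases y)
  have scaled: "passive_matrix (l, m) = (if l = m then 1/2 else 1) *\<^sub>R bsX_matrix l m" if "l \<le> m"
    using that by (auto simp: passive_matrix.simps)
  have neq: "(j = l \<and> k = m) = False" "(k = m \<and> j = l) = False"
    using assms x y by blast+
  show ?thesis
  proof (cases "j \<le> k"; cases "l \<le> m")
    assume le: "j \<le> k" "l \<le> m"
    \<comment> \<open>With both pairs weakly increasing, a swap would make all four modes equal and
      hence \<open>x = y\<close>.\<close>
    then have F: "(j = m \<and> k = l) = False"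
      using neq by (metis order_antisym)
    have "bsX_matrix l m $ Inr j $ Inl k = 0"
      by (simp only: bsX_matrix_nth neq F) simp
    then show ?thesis
      using le by (simp only: x y scaled root_row.simps root_column.simps if_True vector_scaleR_component
          scaleR_zero_right)
  next
    assume le: "j \<le> k" "\<not> l \<le> m"
    then have "m < l" by simp
    then show ?thesis
      using le by (simp add: x y pair_simps root_row.simps root_column.simps bsY_matrix_nth)
  next
    assume le: "\<not> j \<le> k" "l \<le> m"
    then show ?thesis
      using scaled[OF le(2)] by (auto simp: x y root_row.simps root_column.simps bsX_matrix_nth)
  next
    assume "\<not> j \<le> k" "\<not> l \<le> m"
    then have le: "k < j" "m < l" by simp_all
    then have F: "(k = l \<and> j = m) = False"
      by (metis order_less_asym)
    have "bsY_matrix m l $ Inr k $ Inr j = 0"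
      by (simp only: bsY_matrix_nth neq F)
    then show ?thesis
      using le by (simp add: x y pair_simps)
  qed
qed

lemma transpose_passive_matrix: "transpose (passive_matrix x) = - passive_matrix x"
  by (cases x rule: mode_pair_cases) (simp_all add: pair_simps generator_matrix_eq transpose_add
      transpose_diff transpose_scaleR transpose_matrix_unit algebra_simps)

lemma generator_in_sp: "passive_matrix x \<in> sp" "active_matrix x \<in> sp"
  by (cases x rule: mode_pair_cases; simp add: pair_simps generator_matrix_in_sp
      subspace_scale[OF subspace_sp] subspace_neg[OF subspace_sp])+


section \<open>Hamiltonian matrices\<close>

context bosonic_modes
begin

abbreviation "Q \<equiv> quadrature q p"

definition quadratic_form :: "'n phase_mat \<Rightarrow> 'v \<Rightarrow> 'v" where
  "quadratic_form G v = (\<Sum>a\<in>UNIV. \<Sum>b\<in>UNIV. smul (of_real (G $ a $ b)) (Q a (Q b v)))"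

text \<open>Isolates the relation inside the definite description of
  \<open>hamiltonian_matrix\<close>, so that uniqueness can be proved for \<open>G\<close>
  itself.\<close>

definition quantizes :: "'n phase_mat \<Rightarrow> ('v \<Rightarrow> 'v) \<Rightarrow> bool" where
  "quantizes G g \<longleftrightarrow> transpose G = G \<and>
     (\<exists>c :: real. \<forall>v. g v = smul (1/2) (quadratic_form G v) + smul (of_real c) v)"

section \<open>Commutators of quadratic operators with quadratures, and uniqueness of
  \<open>G\<close>\<close>

lemma module_hom_Q: "module_hom smul smul (Q a)"
  using linear_quadrature by (simp add: Vector_Spaces.linear_def)

lemmas Q_simps =
  module_hom.add[OF module_hom_Q] module_hom.diff[OF module_hom_Q] module_hom.scale[OF module_hom_Q]
  module_hom.sum[OF module_hom_Q]

lemma Q_commute: "Q a (Q b v) = Q b (Q a v) + smul (\<i> * of_real (Omega $ a $ b)) v"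
  using ccr[of a b v] by (simp add: algebra_simps)

lemma quadratic_form_add: "quadratic_form (G + H) v = quadratic_form G v + quadratic_form H v"
  by (simp add: quadratic_form_def scale_left_distrib sum.distrib)

lemma quadratic_form_scaleR: "quadratic_form (c *\<^sub>R G) v = smul (of_real c) (quadratic_form G v)"
  by (simp add: quadratic_form_def scale_sum_right)

lemma quadratic_form_minus: "quadratic_form (- G) v = - quadratic_form G v"
  using quadratic_form_scaleR[of "-1" G v] by simp

lemma quadratic_form_diff: "quadratic_form (G - H) v = quadratic_form G v - quadratic_form H v"
  using quadratic_form_add[of G "- H" v] by (simp add: quadratic_form_minus)

lemma quadratic_form_matrix_unit: "quadratic_form (matrix_unit a b) v = Q a (Q b v)"
proof -
  have "smul (of_real (matrix_unit a b $ i $ j)) (Q i (Q j v))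
      = (if i = a then if j = b then Q a (Q b v) else 0 else 0)" for i j
    by (simp add: matrix_unit_nth)
  then have "quadratic_form (matrix_unit a b) v
      = (\<Sum>i\<in>UNIV. if i = a then \<Sum>j\<in>UNIV. if j = b then Q a (Q b v) else 0 else 0)"
    unfolding quadratic_form_def by (intro sum.cong refl) simp
  then show ?thesis by simp
qed

text \<open>By the Leibniz rule each product \<open>Q a (Q b v)\<close> yields two terms linear in
  the quadratures; symmetry of \<open>G\<close> makes their sums equal, hence the factor 2.\<close>

lemma quadratic_form_commute:
  assumes "transpose G = G"
  shows "quadratic_form G (Q e v) - Q e (quadratic_form G v)
      = (\<Sum>a\<in>UNIV. smul (2 * (\<i> * of_real ((G ** Omega) $ a $ e))) (Q a v))"
proof -
  have sym: "G $ a $ b = G $ b $ a" for a b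
    using arg_cong[OF assms, of "\<lambda>X. X $ b $ a"] by (simp add: transpose_def)
  have comm: "Q a (Q b (Q e v)) - Q e (Q a (Q b v)) =
      smul (\<i> * of_real (Omega $ b $ e)) (Q a v) + smul (\<i> * of_real (Omega $ a $ e)) (Q b v)" for a b
    by (simp add: Q_commute[of b e v] Q_commute[of a e "Q b v"] Q_simps)
  let ?S = "\<Sum>a\<in>UNIV. \<Sum>b\<in>UNIV. smul (\<i> * of_real (G $ a $ b * Omega $ b $ e)) (Q a v)"
  have "quadratic_form G (Q e v) - Q e (quadratic_form G v)
      = (\<Sum>a\<in>UNIV. \<Sum>b\<in>UNIV. smul (of_real (G $ a $ b)) (Q a (Q b (Q e v)) - Q e (Q a (Q b v))))"
    by (simp add: quadratic_form_def Q_simps scale_right_diff_distrib sum_subtractf)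
  also have "\<dots> = ?S
      + (\<Sum>a\<in>UNIV. \<Sum>b\<in>UNIV. smul (\<i> * of_real (G $ a $ b * Omega $ a $ e)) (Q b v))"
    by (simp add: comm scale_right_distrib sum.distrib mult_ac)
  also have "(\<Sum>a\<in>UNIV. \<Sum>b\<in>UNIV. smul (\<i> * of_real (G $ a $ b * Omega $ a $ e)) (Q b v)) = ?S"
    by (subst sum.swap) (simp add: sym)
  also have "?S = (\<Sum>a\<in>UNIV. smul (\<i> * of_real ((G ** Omega) $ a $ e)) (Q a v))"
    by (simp add: matrix_matrix_mult_def scale_sum_left sum_distrib_left)
  finally show ?thesis
    by (simp add: sum.distrib[symmetric] scale_left_distrib[symmetric])
qed

text \<open>The constant of \<open>g\<close> drops out of the first commutator, which is linear in
  the quadratures; the second one is then a scalar by the canonical commutation relations.\<close>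

lemma quantizes_double_commutator:
  assumes "quantizes G g"
  shows "(g (Q e (Q f v)) - Q e (g (Q f v))) - Q f (g (Q e v) - Q e (g v))
      = smul (- of_real ((transpose Omega ** (G ** Omega)) $ f $ e)) v"
proof -
  obtain c :: real where c: "\<And>v. g v = smul (1/2) (quadratic_form G v) + smul (of_real c) v"
    and sym: "transpose G = G"
    using assms by (auto simp: quantizes_def)
  have *: "g (Q e w) - Q e (g w)
      = (\<Sum>a\<in>UNIV. smul (\<i> * of_real ((G ** Omega) $ a $ e)) (Q a w))" for w
  proof -
    have "g (Q e w) - Q e (g w) = smul (1/2) (quadratic_form G (Q e w) - Q e (quadratic_form G w))"
      by (simp add: c Q_simps scale_right_diff_distrib)
    then show ?thesis
      by (simp add: quadratic_form_commute[OF sym] scale_sum_right)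
  qed
  have "smul (\<i> * of_real ((G ** Omega) $ a $ e)) (Q a (Q f v))
      - smul (\<i> * of_real ((G ** Omega) $ a $ e)) (Q f (Q a v))
      = smul (- of_real (Omega $ a $ f * (G ** Omega) $ a $ e)) v" for a
    by (simp add: Q_commute[of a f v] scale_right_distrib mult_ac)
  then have "(\<Sum>a\<in>UNIV. smul (\<i> * of_real ((G ** Omega) $ a $ e)) (Q a (Q f v)))
      - (\<Sum>a\<in>UNIV. smul (\<i> * of_real ((G ** Omega) $ a $ e)) (Q f (Q a v)))
      = (\<Sum>a\<in>UNIV. smul (- of_real (Omega $ a $ f * (G ** Omega) $ a $ e)) v)"
    by (simp only: sum_subtractf[symmetric])
  also have "\<dots> = smul (- of_real ((transpose Omega ** (G ** Omega)) $ f $ e)) v"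
    unfolding matrix_matrix_mult_def[of "transpose Omega"]
    by (simp add: transpose_def scale_sum_left sum_negf)
  finally show ?thesis
    by (simp add: * Q_simps)
qed

text \<open>A nonzero vector lets the scalars of the double commutators be compared, and conjugation
  by \<open>Omega\<close> merely permutes the entries of a matrix up to sign.\<close>

lemma quantizes_unique:
  assumes "quantizes G g" "quantizes H g"
  shows "G = H"
proof -
  obtain v :: 'v where v: "v \<noteq> 0" using nontrivial by blast
  have eq: "(transpose Omega ** (G ** Omega)) $ f $ e = (transpose Omega ** (H ** Omega)) $ f $ e" for e f
    using quantizes_double_commutator[OF assms(1), of e f v]
      quantizes_double_commutator[OF assms(2), of e f v] v by simp
  have conj: "(transpose Omega ** (X ** Omega)) $ conj_index a $ conj_index b
      = index_sign a * index_sign b * X $ a $ b" for X :: "'n phase_mat" and a b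
  proof -
    have t: "transpose (Omega :: 'n phase_mat) = - Omega"
      by (auto simp: vec_eq_iff transpose_def Omega_nth)
    have "(- Omega) ** (X ** Omega) = - (Omega ** (X ** Omega))"
      by (simp add: vec_eq_iff matrix_matrix_mult_def sum_negf)
    then show ?thesis
      by (simp add: t Omega_mult_nth mult_Omega_nth)
  qed
  show ?thesis
    using eq[of "conj_index _" "conj_index _"] by (simp add: vec_eq_iff conj)
qed

lemma hamiltonian_matrix_eq:
  assumes "quantizes G g"
  shows "hamiltonian_matrix smul q p g = Omega ** G"
proof -
  have "hamiltonian_matrix smul q p g = (THE K. \<exists>G. quantizes G g \<and> K = Omega ** G)"
    unfolding hamiltonian_matrix_def quantizes_def quadratic_form_def by (rule arg_cong[of _ _ The]) blast
  then show ?thesis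
    using assms quantizes_unique by (auto intro!: the_equality)
qed

lemma quantizes_scaleR:
  assumes "quantizes G g" and "\<And>v. h v = smul (of_real c) (g v)"
  shows "quantizes (c *\<^sub>R G) h"
proof -
  obtain d :: real where "\<And>v. g v = smul (1/2) (quadratic_form G v) + smul (of_real d) v"
    using assms by (auto simp: quantizes_def)
  then have "h v = smul (1/2) (quadratic_form (c *\<^sub>R G) v) + smul (of_real (c * d)) v" for v
    by (simp add: assms(2) quadratic_form_scaleR scale_right_distrib)
  moreover have "transpose (c *\<^sub>R G) = c *\<^sub>R G"
    using assms(1) by (simp add: quantizes_def vec_eq_iff transpose_def)
  ultimately show ?thesis unfolding quantizes_def by blast
qed

section \<open>Ladder operators and the Hamiltonian matrices of the generators\<close>

abbreviation "an \<equiv> annihilation smul q p"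
abbreviation "cr \<equiv> creation smul q p"

lemma ladder_products:
  shows cr_an: "cr j (an k v) = smul (1/2) (Q (Inl j) (Q (Inl k) v) + smul \<i> (Q (Inl j) (Q (Inr k) v))
      - smul \<i> (Q (Inr j) (Q (Inl k) v)) + Q (Inr j) (Q (Inr k) v))"
    and cr_cr: "cr j (cr k v) = smul (1/2) (Q (Inl j) (Q (Inl k) v) - smul \<i> (Q (Inl j) (Q (Inr k) v))
      - smul \<i> (Q (Inr j) (Q (Inl k) v)) - Q (Inr j) (Q (Inr k) v))"
    and an_an: "an j (an k v) = smul (1/2) (Q (Inl j) (Q (Inl k) v) + smul \<i> (Q (Inl j) (Q (Inr k) v))
      + smul \<i> (Q (Inr j) (Q (Inl k) v)) - Q (Inr j) (Q (Inr k) v))"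
proof -
  \<comment> \<open>Naming the normalisation hides the square root: only \<open>s * s = 1/2\<close>
    matters, restated below for the nested products that arise.\<close>
  define s where "s = 1 / complex_of_real (sqrt 2)"
  have "s * s = 1/2"
    by (simp add: s_def flip: of_real_mult)
  then have half: "s * (s * c) = c / 2" for c
    by (metis mult.assoc mult_1 times_divide_eq_left)
  have s: "s * s = 1/2" "s * (\<i> * s) = \<i> / 2" "s * (\<i> * (s * \<i>)) = - 1/2"
    by (simp_all only: \<open>s * s = 1/2\<close> half mult.left_commute[of s \<i>]) simp_all
  have an: "an j v = smul s (Q (Inl j) v + smul \<i> (Q (Inr j) v))"
    and cr: "cr j v = smul s (Q (Inl j) v - smul \<i> (Q (Inr j) v))" for j v
    by (simp_all add: annihilation_def creation_def quadrature_def s_def)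
  show "cr j (an k v) = smul (1/2) (Q (Inl j) (Q (Inl k) v) + smul \<i> (Q (Inl j) (Q (Inr k) v))
      - smul \<i> (Q (Inr j) (Q (Inl k) v)) + Q (Inr j) (Q (Inr k) v))"
    by (simp add: an cr Q_simps scale_right_distrib scale_right_diff_distrib s half)
  show "cr j (cr k v) = smul (1/2) (Q (Inl j) (Q (Inl k) v) - smul \<i> (Q (Inl j) (Q (Inr k) v))
      - smul \<i> (Q (Inr j) (Q (Inl k) v)) - Q (Inr j) (Q (Inr k) v))"
    by (simp add: an cr Q_simps scale_right_distrib scale_right_diff_distrib s half)
  show "an j (an k v) = smul (1/2) (Q (Inl j) (Q (Inl k) v) + smul \<i> (Q (Inl j) (Q (Inr k) v))
      + smul \<i> (Q (Inr j) (Q (Inl k) v)) - Q (Inr j) (Q (Inr k) v))"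
    by (simp add: an cr Q_simps scale_right_distrib scale_right_diff_distrib s half)
qed


lemma quadratic_form_symmetrized_unit:
  "quadratic_form (symmetrized_unit a b) v = Q a (Q b v) + Q b (Q a v)"
  by (simp add: symmetrized_unit_def quadratic_form_add quadratic_form_matrix_unit)

lemma smul_half_add: "smul (1/2) v + smul (1/2) v = v"
  by (simp flip: scale_left_distrib)

lemma quantizesI:
  assumes "transpose G = G"
    and "\<And>v. g v = smul (1/2) (quadratic_form G v) + smul (of_real c) v"
  shows "quantizes G g"
  unfolding quantizes_def using assms by blast

text \<open>The additive constant comes from normal ordering: it is -1 for \<open>j = k\<close>,
  where the operator is twice the number operator, and 0 for distinct modes, whose quadratures
  commute.\<close>

lemma quantizes_bsX:
  "quantizes (symmetrized_unit (Inl j) (Inl k) + symmetrized_unit (Inr j) (Inr k)) (g_bsX smul q p j k)"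
proof (rule quantizesI)
  fix v
  have "- smul (1/2) v - smul (1/2) v = - v"
    using smul_half_add[of v] by (metis minus_add_distrib uminus_add_conv_diff add.commute)
  then show "g_bsX smul q p j k v = smul (1/2) (quadratic_form
      (symmetrized_unit (Inl j) (Inl k) + symmetrized_unit (Inr j) (Inr k)) v)
      + smul (of_real (if j = k then - 1 else 0)) v"
    by (simp add: g_bsX_def ladder_products quadratic_form_add quadratic_form_symmetrized_unit
        Q_commute[of "Inr j" "Inl k"] Q_commute[of "Inr k" "Inl j"] Omega_nth
        scale_right_distrib scale_right_diff_distrib)
qed (simp add: transpose_add transpose_diff transpose_minus transpose_symmetrized_unit)

text \<open>The constant vanishes because the products of a position with a momentum already occur
  in both orders.\<close>

lemma quantizes_bsY:
  "quantizes (symmetrized_unit (Inl j) (Inr k) - symmetrized_unit (Inr j) (Inl k)) (g_bsY smul q p j k)"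
proof (rule quantizesI)
  fix v
  show "g_bsY smul q p j k v = smul (1/2) (quadratic_form
      (symmetrized_unit (Inl j) (Inr k) - symmetrized_unit (Inr j) (Inl k)) v) + smul (of_real 0) v"
    by (simp add: g_bsY_def ladder_products quadratic_form_diff quadratic_form_symmetrized_unit
        Q_commute[of "Inl k" "Inl j"] Q_commute[of "Inr k" "Inr j"] Omega_nth
        scale_right_distrib scale_right_diff_distrib)
qed (simp add: transpose_add transpose_diff transpose_minus transpose_symmetrized_unit)

lemma quantizes_tsX:
  "quantizes (symmetrized_unit (Inl j) (Inl k) - symmetrized_unit (Inr j) (Inr k)) (g_tsX smul q p j k)"
proof (rule quantizesI)
  fix v
  show "g_tsX smul q p j k v = smul (1/2) (quadratic_form
      (symmetrized_unit (Inl j) (Inl k) - symmetrized_unit (Inr j) (Inr k)) v) + smul (of_real 0) v"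
    by (simp add: g_tsX_def ladder_products quadratic_form_diff quadratic_form_symmetrized_unit
        Q_commute[of "Inl k" "Inl j"] Q_commute[of "Inr k" "Inr j"] Omega_nth
        scale_right_distrib scale_right_diff_distrib)
qed (simp add: transpose_add transpose_diff transpose_minus transpose_symmetrized_unit)

text \<open>For \<open>j = k\<close> the two reorderings of position and momentum give opposite
  scalars, so the constant is 0 for all modes.\<close>

lemma quantizes_tsY:
  "quantizes (- symmetrized_unit (Inl j) (Inr k) - symmetrized_unit (Inr j) (Inl k)) (g_tsY smul q p j k)"
proof (rule quantizesI)
  fix v
  show "g_tsY smul q p j k v = smul (1/2) (quadratic_form
      (- symmetrized_unit (Inl j) (Inr k) - symmetrized_unit (Inr j) (Inl k)) v) + smul (of_real 0) v"
    by (simp add: g_tsY_def ladder_products quadratic_form_diff quadratic_form_minus quadratic_form_symmetrized_unit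
        Q_commute[of "Inr k" "Inl j"] Q_commute[of "Inr j" "Inl k"] Omega_nth
        scale_right_distrib scale_right_diff_distrib)
qed (simp add: transpose_add transpose_diff transpose_minus transpose_symmetrized_unit)

lemma hamiltonian_matrix_bsX: "hamiltonian_matrix smul q p (g_bsX smul q p j k) = bsX_matrix j k"
  unfolding bsX_matrix_def by (rule hamiltonian_matrix_eq[OF quantizes_bsX])

lemma hamiltonian_matrix_bsY: "hamiltonian_matrix smul q p (g_bsY smul q p j k) = bsY_matrix j k"
  unfolding bsY_matrix_def by (rule hamiltonian_matrix_eq[OF quantizes_bsY])

lemma hamiltonian_matrix_tsX: "hamiltonian_matrix smul q p (g_tsX smul q p j k) = tsX_matrix j k"
  unfolding tsX_matrix_def by (rule hamiltonian_matrix_eq[OF quantizes_tsX])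

lemma hamiltonian_matrix_tsY: "hamiltonian_matrix smul q p (g_tsY smul q p j k) = tsY_matrix j k"
  unfolding tsY_matrix_def by (rule hamiltonian_matrix_eq[OF quantizes_tsY])

lemma hamiltonian_matrix_rot:
  "hamiltonian_matrix smul q p (g_rot smul q p j) = (1/2) *\<^sub>R bsX_matrix j j"
proof -
  have "g_rot smul q p j v = smul (of_real (1/2)) (g_bsX smul q p j j v)" for v
    by (simp add: g_rot_def g_bsX_def scale_right_distrib smul_half_add)
  from hamiltonian_matrix_eq[OF quantizes_scaleR[OF quantizes_bsX this]]
  show ?thesis by (simp only: bsX_matrix_def Omega_mult_scaleR)
qed

lemma hamiltonian_matrix_sqX:
  "hamiltonian_matrix smul q p (g_sqX smul q p j) = (1/2) *\<^sub>R tsX_matrix j j"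
proof -
  have "g_sqX smul q p j v = smul (of_real (1/2)) (g_tsX smul q p j j v)" for v
    by (simp add: g_sqX_def g_tsX_def)
  from hamiltonian_matrix_eq[OF quantizes_scaleR[OF quantizes_tsX this]]
  show ?thesis by (simp only: tsX_matrix_def Omega_mult_scaleR)
qed

section \<open>Passive and active matrices as elements of \<open>k_alg\<close> and
  \<open>p_space\<close>\<close>

lemma hamiltonian_matrix_passive_generators:
  "hamiltonian_matrix smul q p ` passive_generators smul q p = range passive_matrix"
proof -
  have "(range passive_matrix :: 'n phase_mat set) = {(1/2) *\<^sub>R bsX_matrix j j | j. True} \<union>
      {bsX_matrix j k | j k. j < k} \<union> {bsY_matrix j k | j k. j < k}" (is "_ = ?R")
  proof
    have "passive_matrix x \<in> ?R" for x
      by (cases x rule: mode_pair_cases) (simp_all add: pair_simps, blast+)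
    then show "range passive_matrix \<subseteq> ?R" by blast
    have "(1/2) *\<^sub>R bsX_matrix j j \<in> range passive_matrix" for j :: 'n
      by (rule range_eqI[of _ _ "(j, j)"]) (simp add: pair_simps)
    moreover have "bsX_matrix j k \<in> range passive_matrix" if "j < k" for j k :: 'n
      by (rule range_eqI[of _ _ "(j, k)"]) (simp add: pair_simps that)
    moreover have "bsY_matrix j k \<in> range passive_matrix" if "j < k" for j k :: 'n
      by (rule range_eqI[of _ _ "(k, j)"]) (simp add: pair_simps that)
    ultimately show "?R \<subseteq> range passive_matrix" by blast
  qed
  also have "\<dots> = hamiltonian_matrix smul q p ` passive_generators smul q p"
  proof -
    have "{(1/2) *\<^sub>R bsX_matrix j j | j. True}
        = hamiltonian_matrix smul q p ` {g_rot smul q p j | j. True}"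
      unfolding hamiltonian_matrix_rot[symmetric] by blast
    moreover have "{bsX_matrix j k | j k. j < k}
        = hamiltonian_matrix smul q p ` {g_bsX smul q p j k | j k. j < k}"
      unfolding hamiltonian_matrix_bsX[symmetric] by blast
    moreover have "{bsY_matrix j k | j k. j < k}
        = hamiltonian_matrix smul q p ` {g_bsY smul q p j k | j k. j < k}"
      unfolding hamiltonian_matrix_bsY[symmetric] by blast
    ultimately show ?thesis
      by (simp only: passive_generators_def image_Un)
  qed
  finally show ?thesis ..
qed

end

lemma k_alg_eq:
  assumes "bosonic_modes smul ip q p"
  shows "k_alg smul q p = span (range passive_matrix)"
  by (simp add: k_alg_def bosonic_modes.hamiltonian_matrix_passive_generators[OF assms])

lemma active_matrix_in_p_space:
  assumes modes: "bosonic_modes smul ip q p"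
  shows "active_matrix x \<in> p_space smul q p"
proof -
  obtain j k where x: "x = (j, k)" by (cases x)
  have base: "hamiltonian_matrix smul q p g \<in> p_space smul q p" if "g \<in> active_generators smul q p" for g
    using that by (auto simp: p_space_def intro: span_base)
  have sub: "subspace (p_space smul q p)"
    by (simp add: p_space_def)
  consider "j < k" | "j = k" | "k < j" by fastforce
  then show ?thesis
  proof cases
    case 1
    have "g_tsX smul q p j k \<in> active_generators smul q p"
      using 1 unfolding active_generators_def by blast
    from base[OF this] show ?thesis
      using 1 by (simp add: x pair_simps bosonic_modes.hamiltonian_matrix_tsX[OF modes])
  next
    case 2
    have "g_sqX smul q p j \<in> active_generators smul q p"
      unfolding active_generators_def by blast
    from base[OF this] show ?thesis
      using 2 by (simp add: x pair_simps bosonic_modes.hamiltonian_matrix_sqX[OF modes])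
  next
    case 3
    have "g_tsY smul q p k j \<in> active_generators smul q p"
      using 3 unfolding active_generators_def by blast
    from subspace_neg[OF sub base[OF this]] show ?thesis
      using 3 by (simp add: x pair_simps bosonic_modes.hamiltonian_matrix_tsY[OF modes])
  qed
qed


section \<open>Root spaces\<close>

primrec mode :: "'n + 'n \<Rightarrow> 'n" where
  "mode (Inl j) = j"
| "mode (Inr j) = j"

lemma weight_axis: "weight a (axis m 1) = (if mode a = m then - index_sign a else 0)"
  by (cases a) (simp_all add: axis_def)

lemma index_eq_iff: "a = b \<longleftrightarrow> mode a = mode b \<and> index_sign a = index_sign b"
  by (cases a; cases b) auto

lemma mode_conj_index [simp]: "mode (conj_index a) = mode a"
  by (cases a) auto

lemma index_sign_cases: "index_sign a = 1 \<or> index_sign a = - 1"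
  by (cases a) auto

text \<open>Conjugating an index negates its weight, so the difference is a sum of the signed
  coordinates of \<open>a\<close> and \<open>conj_index b\<close>. These do not cancel since
  \<open>a \<noteq> b\<close>, hence the functional determines them up to order.\<close>

lemma weight_diff_eq:
  assumes "a \<noteq> b" and eq: "\<And>r. weight a r - weight b r = weight c r - weight d r"
  shows "(c = a \<and> d = b) \<or> (c = conj_index b \<and> d = conj_index a)"
proof -
  define s where "s = (index_sign :: 'a + 'a \<Rightarrow> real)"
  have s: "s x = 1 \<or> s x = - 1" for x
    unfolding s_def by (rule index_sign_cases)
  have ab: "\<not> (mode a = mode b \<and> s a = s b)"
    using assms(1) by (simp add: index_eq_iff s_def)
  have eq': "(if mode a = m then - s a else 0) - (if mode b = m then - s b else 0)
      = (if mode c = m then - s c else 0) - (if mode d = m then - s d else 0)" for m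
    using eq[of "axis m 1"] by (simp only: weight_axis s_def)
  \<comment> \<open>Unit vectors at the modes of the four indices suffice, which leaves a finite
    case distinction with signs 1 and -1.\<close>
  have "(mode c = mode a \<and> s c = s a \<and> mode d = mode b \<and> s d = s b) \<or>
      (mode c = mode b \<and> s c = - s b \<and> mode d = mode a \<and> s d = - s a)"
    using ab s[of a] s[of b] s[of c] s[of d] eq'[of "mode a"] eq'[of "mode b"] eq'[of "mode c"] eq'[of "mode d"]
    by (smt (z3))
  then show ?thesis
    by (simp add: index_eq_iff s_def)
qed

lemma weight_eqD:
  assumes "\<And>r. weight a r = weight b r"
  shows "a = b"
proof (rule ccontr)
  assume "a \<noteq> b"
  \<comment> \<open>Equal weights would present the zero functional also by the pairs
    \<open>(a, a)\<close> and \<open>(b, b)\<close>, forcing a fixed point of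
    \<open>conj_index\<close>.\<close>
  from weight_diff_eq[OF this, of a a] weight_diff_eq[OF this, of b b] assms
  have "a = b \<or> (a = conj_index b \<and> a = conj_index a)" by simp
  then show False
    using \<open>a \<noteq> b\<close> by (cases a) auto
qed

section \<open>Root spaces are lines; the positive roots are distinct restricted roots\<close>

lemma linear_weight: "linear (weight a)"
  by (cases a) (auto intro!: linearI)

lemma commutator_squeeze_0: "commutator (squeeze r) 0 = 0"
  by (simp add: vec_eq_iff commutator_squeeze_nth)

lemma subspace_root_space: "subspace (root_space \<alpha>)"
proof (rule subspaceI)
  show "0 \<in> root_space \<alpha>"
    by (simp add: root_space_def subspace_0[OF subspace_sp] commutator_squeeze_0)
next
  fix X Y assume "X \<in> root_space \<alpha>" "Y \<in> root_space \<alpha>"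
  then show "X + Y \<in> root_space \<alpha>"
    by (simp add: root_space_def subspace_add[OF subspace_sp] commutator_squeeze_linear scaleR_right_distrib)
next
  fix c X assume "X \<in> root_space \<alpha>"
  then show "c *\<^sub>R X \<in> root_space \<alpha>"
    by (simp add: root_space_def subspace_scale[OF subspace_sp] commutator_squeeze_linear mult.commute)
qed

lemma root_space_nth:
  assumes "X \<in> root_space \<alpha>" "X $ a $ b \<noteq> 0"
  shows "\<alpha> r = weight a r - weight b r"
proof -
  have "commutator (squeeze r) X $ a $ b = (\<alpha> r *\<^sub>R X) $ a $ b"
    using assms(1) by (simp add: root_space_def)
  then show ?thesis
    using assms(2) by (simp add: commutator_squeeze_nth)
qed

lemma dim_root_space:
  assumes "\<alpha> \<noteq> (\<lambda>r. 0)" "root_space \<alpha> \<noteq> {0}"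
  shows "dim (root_space \<alpha>) = 1"
proof -
  have "0 \<in> root_space \<alpha>"
    by (rule subspace_0[OF subspace_root_space])
  with assms(2) obtain X where X: "X \<in> root_space \<alpha>" "X \<noteq> 0"
    by blast
  then obtain a b where nz: "X $ a $ b \<noteq> 0"
    by (auto simp: vec_eq_iff)
  have \<alpha>: "\<alpha> r = weight a r - weight b r" for r
    by (rule root_space_nth[OF X(1) nz])
  with assms(1) have "a \<noteq> b"
    by (auto simp: fun_eq_iff)
  have "Y \<in> span {X}" if Y: "Y \<in> root_space \<alpha>" for Y
  proof -
    \<comment> \<open>Chosen so that \<open>Y - c *\<^sub>R X\<close> vanishes at
      \<open>(a, b)\<close>; any other nonzero entry would lie at the conjugate place, which
      \<open>sp\<close> excludes.\<close>
    define c where "c = Y $ a $ b / X $ a $ b"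
    define Z where "Z = Y - c *\<^sub>R X"
    have Z: "Z \<in> root_space \<alpha>"
      unfolding Z_def by (intro subspace_diff subspace_scale subspace_root_space X Y)
    have Zab: "Z $ a $ b = 0"
      using nz by (simp add: Z_def c_def)
    have "Z $ i $ j = 0" for i j
    proof (rule ccontr)
      assume ij: "Z $ i $ j \<noteq> 0"
      have "weight a r - weight b r = weight i r - weight j r" for r
        using \<alpha>[of r] root_space_nth[OF Z ij, of r] by simp
      then have "(i = a \<and> j = b) \<or> (i = conj_index b \<and> j = conj_index a)"
        by (rule weight_diff_eq[OF \<open>a \<noteq> b\<close>])
      moreover have "Z \<in> sp"
        using Z by (simp add: root_space_def)
      ultimately show False
        using ij Zab sp_nth_eq_0_iff[of Z b a] by blast
    qed
    then have "Y = c *\<^sub>R X"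
      by (simp add: Z_def vec_eq_iff)
    then show ?thesis
      by (simp add: span_scale span_base)
  qed
  then show ?thesis
    using X by (intro dim_unique[of "{X}"]) auto
qed

text \<open>If two pairs had the same root, the marked entry of \<open>y\<close> would be that of
  \<open>x\<close> or its conjugate. The matrix of \<open>x\<close> is nonzero at both of these, yet
  it vanishes at the marked entry of \<open>y\<close>.\<close>

lemma inj_pair_root: "inj (pair_root :: _ \<Rightarrow> 'n::{finite,linorder} functional)"
proof (rule injI, rule ccontr)
  fix x y :: "'n \<times> 'n"
  assume eq: "pair_root x = pair_root y" and "x \<noteq> y"
  have "(root_row y = root_row x \<and> root_column y = root_column x) \<or>
      (root_row y = conj_index (root_column x) \<and> root_column y = conj_index (root_row x))"
    by (rule weight_diff_eq[OF root_row_neq_root_column])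
      (simp only: pair_root_eq_weights[symmetric] eq)
  moreover have "passive_matrix x $ root_row y $ root_column y = 0"
    by (rule passive_matrix_nth_other_root) (use \<open>x \<noteq> y\<close> in blast)
  ultimately have "passive_matrix x $ root_row x $ root_column x = 0"
    using sp_nth_eq_0_iff[OF generator_in_sp(1)] by metis
  then show False
    by (simp add: passive_matrix_nth_root)
qed

lemma restricted_root_pair_root: "restricted_root (pair_root x)"
proof -
  have "linear (pair_root x)"
    unfolding pair_root_eq_weights[abs_def] by (intro linear_compose_sub linear_weight)
  moreover have "pair_root x \<noteq> (\<lambda>r. 0)"
    using root_row_neq_root_column[of x] weight_eqD[of "root_row x" "root_column x"]
    by (auto simp: fun_eq_iff pair_root_eq_weights)
  \<comment> \<open>The bracket exchanges the two summands up to the factor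
    \<open>pair_root x r\<close>, so their sum is a root vector.\<close>
  moreover have "passive_matrix x + active_matrix x \<in> root_space (pair_root x)"
    by (simp add: root_space_def subspace_add[OF subspace_sp] generator_in_sp commutator_squeeze_linear
        commutator_squeeze_passive_matrix commutator_squeeze_active_matrix scaleR_right_distrib)
  moreover have "passive_matrix x + active_matrix x \<noteq> 0"
  proof
    assume "passive_matrix x + active_matrix x = 0"
    from arg_cong[OF this, of "\<lambda>X. X $ root_row x $ root_column x"] show False
      by (simp add: passive_matrix_nth_root active_matrix_nth_root)
  qed
  ultimately show ?thesis
    unfolding restricted_root_def by blast
qed

lemma centralizer_of_squeezing_flat:
  "centralizer_in (span (range passive_matrix) :: 'n::{finite,linorder} phase_mat set) squeezing_flat = {0}"
proof -
  let ?k = "span (range passive_matrix) :: 'n phase_mat set"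
  have "subspace {X :: 'n phase_mat. transpose X = - X}"
    by (simp add: subspace_def transpose_add transpose_scaleR) (simp add: transpose_def vec_eq_iff)
  then have skew: "?k \<subseteq> {X. transpose X = - X}"
    by (intro span_minimal) (auto simp: transpose_passive_matrix)
  have "X = 0" if X: "X \<in> ?k" "\<And>r. commutator (squeeze r) X = 0" for X
  proof -
    have "X $ a $ b = 0" for a b
    proof (cases "a = b")
      case True
      have "transpose X $ a $ a = (- X) $ a $ a"
        using skew X(1) by auto
      with True show ?thesis
        by (simp add: transpose_def)
    next
      case False
      then obtain r where "weight a r \<noteq> weight b r"
        using weight_eqD by blast
      moreover have "(weight a r - weight b r) * X $ a $ b = 0"
        using X(2)[of r] by (simp flip: commutator_squeeze_nth)
      ultimately show ?thesis by simp
    qed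
    then show ?thesis by (simp add: vec_eq_iff)
  qed
  then show ?thesis
    by (auto simp: centralizer_in_def squeezing_flat_def span_zero commutator_squeeze_0)
qed


section \<open>Bases and dimensions\<close>

lemma dual_family_independent:
  fixes f :: "'i \<Rightarrow> 'b::real_vector" and l :: "'i \<Rightarrow> 'b \<Rightarrow> real"
  assumes lin: "\<And>i. linear (l i)" and self: "\<And>i. l i (f i) \<noteq> 0"
    and other: "\<And>i j. i \<noteq> j \<Longrightarrow> l i (f j) = 0"
  shows "inj f" "independent (range f)"
proof -
  show "inj f"
    using self other by (metis injI)
  show "independent (range f)"
  proof
    assume "dependent (range f)"
    then obtain i where i: "f i \<in> span (range f - {f i})"
      unfolding dependent_def by blast
    have "l i x = 0" if x: "x \<in> range f - {f i}" for x
    proof -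
      obtain j where "x = f j" using x by blast
      moreover from this x have "i \<noteq> j" by blast
      ultimately show ?thesis by (simp add: other)
    qed
    with linear_eq_0_on_span[OF lin this i] self show False by blast
  qed
qed

lemma passive_matrix_independent:
  "inj (passive_matrix :: _ \<Rightarrow> 'n::{finite,linorder} phase_mat)"
  "independent (range (passive_matrix :: _ \<Rightarrow> 'n phase_mat))"
proof -
  let ?l = "\<lambda>x (X :: 'n phase_mat). X $ root_row x $ root_column x"
  have "linear (?l x)" for x
    by (auto intro!: linearI)
  from dual_family_independent[of ?l passive_matrix, OF this]
  show "inj (passive_matrix :: _ \<Rightarrow> 'n phase_mat)" "independent (range (passive_matrix :: _ \<Rightarrow> 'n phase_mat))"
    by (simp_all add: passive_matrix_nth_root passive_matrix_nth_other_root)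
qed

text \<open>A skew-Hermitian matrix has an antisymmetric real and a symmetric imaginary part, so it
  amounts to the real matrix which is their sum.\<close>

lemma dim_u_alg: "dim (u_alg :: 'n::finite complex_mat set) = CARD('n)\<^sup>2"
proof -
  define F :: "real ^ 'n ^ 'n \<Rightarrow> 'n complex_mat" where
    "F M = (\<chi> i j. Complex ((M $ i $ j - M $ j $ i) / 2) ((M $ i $ j + M $ j $ i) / 2))" for M
  have F_nth: "Re (F M $ i $ j) = (M $ i $ j - M $ j $ i) / 2"
    "Im (F M $ i $ j) = (M $ i $ j + M $ j $ i) / 2" for M i j
    by (simp_all add: F_def)
  have "linear F"
    by (rule linearI) (simp_all add: vec_eq_iff complex_eq_iff F_nth field_simps)
  moreover have "inj F"
  proof (rule injI)
    fix M N assume eq: "F M = F N"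
    \<comment> \<open>A real matrix is the sum of its antisymmetric and symmetric parts.\<close>
    have inv: "M $ i $ j = Re (F M $ i $ j) + Im (F M $ i $ j)" for M i j
      by (simp add: F_nth field_simps)
    have "M $ i $ j = N $ i $ j" for i j
      unfolding inv[of M i j] inv[of N i j] eq ..
    then show "M = N" by (simp add: vec_eq_iff)
  qed
  moreover have "range F = u_alg"
  proof
    have "F M $ i $ j = - cnj (F M $ j $ i)" for M i j
      by (rule complex_eqI) (simp_all add: F_nth field_simps)
    then show "range F \<subseteq> u_alg"
      unfolding u_alg_def by blast
    show "u_alg \<subseteq> range F"
    proof
      fix X :: "'n complex_mat"
      assume "X \<in> u_alg"
      then have X: "X $ i $ j = - cnj (X $ j $ i)" for i j
        unfolding u_alg_def by blast
      have "F (\<chi> i j. Re (X $ i $ j) + Im (X $ i $ j)) $ i $ j = X $ i $ j" for i j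
        by (rule complex_eqI) (simp_all add: F_nth X[of j i])
      then have "X = F (\<chi> i j. Re (X $ i $ j) + Im (X $ i $ j))"
        by (simp add: vec_eq_iff)
      then show "X \<in> range F" by (rule range_eqI)
    qed
  qed
  ultimately have "dim (u_alg :: 'n complex_mat set) = dim (UNIV :: (real ^ 'n ^ 'n) set)"
    using dim_image_eq[of F UNIV] by simp
  then show ?thesis
    by (simp add: power2_eq_square)
qed

theorem propositionS12:
  fixes smul :: "complex \<Rightarrow> 'v::ab_group_add \<Rightarrow> 'v"
    and ip :: "'v \<Rightarrow> 'v \<Rightarrow> complex"
    and q p :: "'n::{finite,linorder} \<Rightarrow> 'v \<Rightarrow> 'v"
    and K :: "'n functional \<Rightarrow> 'n phase_mat"
  assumes modes: "bosonic_modes smul ip q p"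
    and K_2e: "\<And>j. K (root_2e j) = hamiltonian_matrix smul q p (g_rot smul q p j)"
    and K_diff: "\<And>j k. j < k \<Longrightarrow>
      K (root_diff j k) = hamiltonian_matrix smul q p (g_bsY smul q p j k)"
    and K_sum: "\<And>j k. j < k \<Longrightarrow>
      K (root_sum j k) = hamiltonian_matrix smul q p (g_bsX smul q p j k)"
  shows "(\<forall>\<alpha>\<in>positive_roots. \<exists>P\<in>p_space smul q p. \<forall>r.
            commutator (squeeze r) (K \<alpha>) = \<alpha> r *\<^sub>R P \<and>
            commutator (squeeze r) P = \<alpha> r *\<^sub>R K \<alpha>)
    \<and> (\<exists>B. bij_betw K positive_roots B \<and> independent B \<and> span B = k_alg smul q p)
    \<and> card (positive_roots :: 'n functional set) = CARD('n) + CARD('n) * (CARD('n) - 1)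
    \<and> CARD('n) + CARD('n) * (CARD('n) - 1) = CARD('n)\<^sup>2
    \<and> CARD('n)\<^sup>2 = dim (u_alg :: 'n complex_mat set)
    \<and> (\<forall>\<alpha>\<in>positive_roots :: 'n functional set. restricted_root \<alpha>)
    \<and> (\<forall>\<alpha> :: 'n functional. restricted_root \<alpha> \<longrightarrow> root_multiplicity \<alpha> = 1)
    \<and> centralizer_in (k_alg smul q p) squeezing_flat = {0}"
proof -
  note hamiltonian_matrices = bosonic_modes.hamiltonian_matrix_rot[OF modes]
    bosonic_modes.hamiltonian_matrix_bsX[OF modes] bosonic_modes.hamiltonian_matrix_bsY[OF modes]
  \<comment> \<open>The three hypotheses on \<open>K\<close> become one statement over pairs, with
    the roots \<open>root_2e j\<close> on the diagonal.\<close>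
  have K: "K (pair_root x) = passive_matrix x" for x
    by (cases x rule: mode_pair_cases)
      (simp_all add: pair_simps root_sum_self K_2e K_diff K_sum 
        hamiltonian_matrices)
  have "\<forall>\<alpha>\<in>positive_roots. \<exists>P\<in>p_space smul q p. \<forall>r.
      commutator (squeeze r) (K \<alpha>) = \<alpha> r *\<^sub>R P \<and> commutator (squeeze r) P = \<alpha> r *\<^sub>R K \<alpha>"
  proof
    fix \<alpha> :: "'n functional"
    assume "\<alpha> \<in> positive_roots"
    then obtain x where "\<alpha> = pair_root x"
      unfolding range_pair_root[symmetric] by blast
    then show "\<exists>P\<in>p_space smul q p. \<forall>r.
        commutator (squeeze r) (K \<alpha>) = \<alpha> r *\<^sub>R P \<and> commutator (squeeze r) P = \<alpha> r *\<^sub>R K \<alpha>"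
      by (intro bexI[of _ "active_matrix x"] active_matrix_in_p_space[OF modes])
        (simp add: K commutator_squeeze_passive_matrix commutator_squeeze_active_matrix)
  qed
  moreover have "bij_betw K positive_roots (range passive_matrix)"
  proof -
    have "K \<circ> pair_root = passive_matrix"
      by (simp add: fun_eq_iff K)
    \<comment> \<open>Injectivity of the composite passes to \<open>K\<close> on the image of
      \<open>pair_root\<close>.\<close>
    then have "inj_on K (range pair_root)" "K ` range pair_root = range passive_matrix"
      using passive_matrix_independent(1) by (metis inj_on_imageI, metis image_comp)
    then show ?thesis
      by (simp add: bij_betw_def range_pair_root)
  qed
  then have "\<exists>B. bij_betw K positive_roots B \<and> independent B \<and> span B = k_alg smul q p"
    using passive_matrix_independent(2) k_alg_eq[OF modes] by blast
  moreover have sq: "CARD('n) + CARD('n) * (CARD('n) - 1) = CARD('n)\<^sup>2"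
    using zero_less_card_finite[where 'a = 'n] by (cases "CARD('n)") (simp_all add: power2_eq_square)
  \<comment> \<open>Positive roots correspond one to one to all ordered pairs of modes.\<close>
  moreover have "card (positive_roots :: 'n functional set) = CARD('n)\<^sup>2"
    unfolding range_pair_root[symmetric]
    by (simp add: card_image[OF inj_pair_root] power2_eq_square)
  moreover have "\<forall>\<alpha>\<in>positive_roots :: 'n functional set. restricted_root \<alpha>"
    unfolding range_pair_root[symmetric] by (auto simp: restricted_root_pair_root)
  moreover have "\<forall>\<alpha> :: 'n functional. restricted_root \<alpha> \<longrightarrow> root_multiplicity \<alpha> = 1"
    by (simp add: restricted_root_def root_multiplicity_def dim_root_space)
  moreover have "centralizer_in (k_alg smul q p) squeezing_flat = {0}"
    by (simp only: k_alg_eq[OF modes] centralizer_of_squeezing_flat)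
  ultimately show ?thesis
    by (simp only: dim_u_alg sq simp_thms)
qed

end
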